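(* For any two Dedekind cuts $(A|B)$, $(C|D)$, we have $$\tau\big((A|B)\boxplus(C|D)\big)=\tau\big((A|B)\big)\,\widehat{\oplus}\,\tau\big((C|D)\big).$$
   Context: $\mathbb N=\{1,2,3,\dots\}$ and $\mathcal Z_{10}=\{0,1,\dots,9\}$. $\mathcal R$ is the set of all formal decimals $x=x_0.x_1x_2x_3\cdots$ with $x_0\in\mathbb Z$ and $x_k\in\mathcal Z_{10}$ for $k\in\mathbb N$; two elements are equal iff all their digits agree. For $k\in\mathbb N$, $[x]_k=\sum_{i=0}^k x_i10^{-i}\in\mathbb Q$. Order on $\mathcal R$: $x\preceq y$ iff $[x]_k\le [y]_k$ for all $k\in\mathbb N$. Every nonempty bounded above (below) subset of $(\mathcal R,\preceq)$ has a supremum (infimum); $\sup$ and $\inf$ are taken in $(\mathcal R,\preceq)$. $x\sim y$ ("no gap") means that there is no $z\in\mathcal R\setminus\{x,y\}$ lying strictly between $x$ and $y$ with respect to $\preceq$; $\sim$ is an equivalence relation, $\mathbb R:=\mathcal R/\sim$, and $[x]$ denotes the class of $x$. $\mathbb Q$ is regarded as a subset of $\mathcal R$ via long division: $\alpha=q/p$ ($p\in\mathbb N$, $q\in\mathbb Z$) is identified with $\alpha_0.\alpha_1\alpha_2\cdots$, where $\alpha_0=\lfloor q/p\rfloor$, $\beta_0=q-\alpha_0p$, $\alpha_{k+1}=\lfloor 10\beta_k/p\rfloor$, $\beta_{k+1}=10\beta_k-\alpha_{k+1}p$. For a bounded sequence $\{x^{(n)}\}_{n\in\mathbb N}$ in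 $\mathcal R$: $\overline{\mathrm{LIMIT}}(\{x^{(n)}\})=\inf\{\sup\{x^{(k)}: k\ge n\}: n\in\mathbb N\}$ and $\underline{\mathrm{LIMIT}}(\{x^{(n)}\})=\sup\{\inf\{x^{(k)}: k\ge n\}: n\in\mathbb N\}$; if they are equal, the common value is denoted $\mathrm{LIMIT}(\{x^{(n)}\})$. It exists for bounded monotone sequences. Addition on $\mathcal R$: $x\oplus y=\mathrm{LIMIT}(\{[x]_k+[y]_k\}_{k\in\mathbb N})$, sums taken in $\mathbb Q$. It respects $\sim$, and $[x]\,\widehat\oplus\,[y]:=[x\oplus y]$ on $\mathbb R$. A Dedekind cut $(A|B)$ is a pair of nonempty subsets $A,B$ of $\mathbb Q$ such that $A\cap B=\emptyset$, $A\cup B=\mathbb Q$; $a<b$ for all $a\in A$, $b\in B$; and $A$ contains no greatest element. $\mathbf{DR}$ is the set of all Dedekind cuts. For every Dedekind cut $\sup A\sim\inf B$, and $\tau:\mathbf{DR}\to\mathbb R$ is $\tau((A|B))=[\sup A]=[\inf B]$. A generalized Dedekind cut $[A\Rsh B]$ is a pair satisfying the same conditions except that $A$ may have a greatest element; it is identified with the Dedekind cut obtained by moving the greatest element of $A$, if it exists, from $A$ to $B$. Addition of cuts: $(A|B)\boxplus(C|D)=[\mathbb Q\setminus(B+D)\Rsh B+D]$, where $B+D=\{b+d: b\in B,d\in D\}$. *)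

theory Defs
  imports Complex_Main "HOL-Library.Set_Algebras"
begin

section \<open>Formal decimals\<close>

typedef decimal = "{x :: nat \<Rightarrow> int. \<forall>k\<ge>1. x k \<in> {0..9}}"
  morphisms digit Decimal
  by (rule exI[of _ "\<lambda>_. 0"]) simp

setup_lifting type_definition_decimal

definition trunc :: "decimal \<Rightarrow> nat \<Rightarrow> rat"
  where "trunc x k = (\<Sum>i=0..k. of_int (digit x i) / 10 ^ i)"

text \<open>\<open>scaled x k\<close> is the integer \<open>10 ^ k * trunc x k\<close>; it is only used in proofs.\<close>

primrec scaled :: "decimal \<Rightarrow> nat \<Rightarrow> int" where
  "scaled x 0 = digit x 0"
| "scaled x (Suc k) = 10 * scaled x k + digit x (Suc k)"

lemma digit_bounds: "0 \<le> digit x (Suc k)" "digit x (Suc k) \<le> 9"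
  using digit[of x] by auto

lemma trunc_scaled: "trunc x k = of_int (scaled x k) / 10 ^ k"
proof (induction k)
  case (Suc k)
  have "trunc x (Suc k) = trunc x k + of_int (digit x (Suc k)) / 10 ^ Suc k"
    by (simp add: trunc_def)
  then show ?case by (simp add: Suc field_simps)
qed (simp add: trunc_def)

lemma trunc_le_iff: "trunc x k \<le> trunc y k \<longleftrightarrow> scaled x k \<le> scaled y k"
  by (simp add: trunc_scaled divide_le_cancel)

lemma scaled_div: "scaled x (Suc k) div 10 = scaled x k"
  using digit_bounds[of x k] by simp

lemma scaled_le_Suc: "scaled x (Suc k) \<le> scaled y (Suc k) \<Longrightarrow> scaled x k \<le> scaled y k"
  by (metis scaled_div zdiv_mono1 zero_less_numeral)

lemma scaled_less_mono:
  assumes "scaled x k < scaled y k" "k \<le> j" shows "scaled x j < scaled y j"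
  using assms(2) assms(1)
proof (induction j rule: dec_induct)
  case (step j)
  then show ?case using scaled_le_Suc[of y j x] by force
qed

lemma decimal_eqI:
  assumes "\<And>k. scaled x k = scaled y k" shows "x = y"
proof -
  have "digit x k = digit y k" for k
  proof (cases k)
    case 0 then show ?thesis using assms[of 0] by simp
  next
    case (Suc j) then show ?thesis using assms[of "Suc j"] assms[of j] by simp
  qed
  then show ?thesis by (metis digit_inject ext)
qed

lemma decimal_of_scaled:
  assumes "\<And>k. M (Suc k) div 10 = (M k :: int)"
  obtains x where "\<And>k. scaled x k = M k"
proof -
  define d where "d k = (case k of 0 \<Rightarrow> M 0 | Suc j \<Rightarrow> M (Suc j) - 10 * M j)" for k
  have "d (Suc k) \<in> {0..9}" for k
    using assms[of k] by (simp add: d_def) presburger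
  then have "\<forall>k\<ge>1. d k \<in> {0..9}"
    by (metis One_nat_def Suc_le_D)
  then have d: "digit (Decimal d) = d"
    by (simp add: Decimal_inverse)
  have "scaled (Decimal d) k = M k" for k
    by (induction k) (simp_all only: scaled.simps d, simp_all add: d_def)
  then show ?thesis using that by blast
qed

instantiation decimal :: linorder
begin

definition less_eq_decimal :: "decimal \<Rightarrow> decimal \<Rightarrow> bool"
  where "x \<le> y \<longleftrightarrow> (\<forall>k\<ge>1. trunc x k \<le> trunc y k)"

definition less_decimal :: "decimal \<Rightarrow> decimal \<Rightarrow> bool"
  where "(x :: decimal) < y \<longleftrightarrow> x \<le> y \<and> \<not> y \<le> x"

lemma decimal_le_iff: "x \<le> y \<longleftrightarrow> (\<forall>k. scaled x k \<le> scaled y k)"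
  unfolding less_eq_decimal_def trunc_le_iff
proof (intro iffI allI)
  fix k assume *: "\<forall>k\<ge>1. scaled x k \<le> scaled y k"
  show "scaled x k \<le> scaled y k"
    using * scaled_le_Suc[of x k y] by (simp del: scaled.simps)
qed auto

instance
proof
  fix x y z :: decimal
  show "x < y \<longleftrightarrow> x \<le> y \<and> \<not> y \<le> x" by (fact less_decimal_def)
  show "x \<le> x" by (simp add: decimal_le_iff)
  show "x \<le> y \<Longrightarrow> y \<le> z \<Longrightarrow> x \<le> z" unfolding decimal_le_iff by (meson order_trans)
  show "x \<le> y \<Longrightarrow> y \<le> x \<Longrightarrow> x = y"
    unfolding decimal_le_iff by (meson antisym decimal_eqI)
  show "x \<le> y \<or> y \<le> x"
  proof (rule ccontr)
    assume "\<not> ?thesis"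
    then obtain j k where jk: "scaled y j < scaled x j" "scaled x k < scaled y k"
      by (auto simp: decimal_le_iff not_le)
    have "scaled y (max j k) < scaled x (max j k)" "scaled x (max j k) < scaled y (max j k)"
      using jk by (auto intro: scaled_less_mono)
    then show False by simp
  qed
qed

end

lemma decimal_less_iff: "x < y \<longleftrightarrow> (\<exists>k. scaled x k < scaled y k)" for x y :: decimal
  by (metis decimal_le_iff linorder_not_le)

text \<open>As a function on all sets, \<open>Sup\<close> is meaningful on nonempty sets that are bounded above,
  and \<open>Inf\<close> on nonempty sets that are bounded below; the class instance below shows that
  the least upper bound and the greatest lower bound do exist there.\<close>

instantiation decimal :: conditionally_complete_linorder
begin

definition sup_decimal :: "decimal \<Rightarrow> decimal \<Rightarrow> decimal" where "sup_decimal = max"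
definition inf_decimal :: "decimal \<Rightarrow> decimal \<Rightarrow> decimal" where "inf_decimal = min"

definition Sup_decimal :: "decimal set \<Rightarrow> decimal"
  where "Sup (S :: decimal set) = (THE s. (\<forall>x\<in>S. x \<le> s) \<and> (\<forall>u. (\<forall>x\<in>S. x \<le> u) \<longrightarrow> s \<le> u))"

definition Inf_decimal :: "decimal set \<Rightarrow> decimal"
  where "Inf (S :: decimal set) = (THE s. (\<forall>x\<in>S. s \<le> x) \<and> (\<forall>u. (\<forall>x\<in>S. u \<le> x) \<longrightarrow> u \<le> s))"

lemma decimal_lub_exists:
  fixes S :: "decimal set"
  assumes "S \<noteq> {}" "bdd_above S"
  obtains s where "\<forall>x\<in>S. x \<le> s" "\<And>u. \<forall>x\<in>S. x \<le> u \<Longrightarrow> s \<le> u"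
proof -
  define M where "M k = Sup ((\<lambda>x. scaled x k) ` S)" for k
  obtain b where b: "\<And>x. x \<in> S \<Longrightarrow> x \<le> b" using assms(2) by (auto simp: bdd_above_def)
  have bdd: "bdd_above ((\<lambda>x. scaled x k) ` S)" for k
    using b by (intro bdd_aboveI2[where M = "scaled b k"]) (auto simp: decimal_le_iff)
  have ub: "scaled x k \<le> M k" if "x \<in> S" for x k
    unfolding M_def using that bdd by (auto intro: cSup_upper)
  have att: "\<exists>x\<in>S. scaled x k = M k" for k
  proof (rule ccontr)
    assume "\<not> ?thesis"
    with ub have "scaled x k \<le> M k - 1" if "x \<in> S" for x
      using that by (metis order_le_less zle_diff1_eq)
    then have "M k \<le> M k - 1"
      using assms(1) cSUP_least[of S "\<lambda>x. scaled x k" "M k - 1"] unfolding M_def by blast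
    then show False by simp
  qed
  have "M (Suc k) div 10 = M k" for k
  proof (rule antisym)
    show "M (Suc k) div 10 \<le> M k" using att[of "Suc k"] ub scaled_div by metis
    show "M k \<le> M (Suc k) div 10" using att[of k] ub scaled_div
      by (metis zdiv_mono1 zero_less_numeral)
  qed
  then obtain s where s: "\<And>k. scaled s k = M k" using decimal_of_scaled[of M] by blast
  show ?thesis
  proof (rule that)
    show "\<forall>x\<in>S. x \<le> s" using ub by (simp add: decimal_le_iff s)
    show "s \<le> u" if "\<forall>x\<in>S. x \<le> u" for u
      using that att by (metis decimal_le_iff s)
  qed
qed

lemma decimal_Sup:
  fixes S :: "decimal set"
  assumes "S \<noteq> {}" "bdd_above S"
  shows "(\<forall>x\<in>S. x \<le> Sup S) \<and> (\<forall>u. (\<forall>x\<in>S. x \<le> u) \<longrightarrow> Sup S \<le> u)"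
proof -
  obtain s where s: "\<forall>x\<in>S. x \<le> s" "\<And>u. \<forall>x\<in>S. x \<le> u \<Longrightarrow> s \<le> u"
    using decimal_lub_exists[OF assms] by blast
  show ?thesis unfolding Sup_decimal_def
    by (rule theI[of _ s]) (use s in \<open>auto intro: antisym\<close>)
qed

lemma decimal_Inf:
  fixes S :: "decimal set"
  assumes "S \<noteq> {}" "bdd_below S"
  shows "(\<forall>x\<in>S. Inf S \<le> x) \<and> (\<forall>u. (\<forall>x\<in>S. u \<le> x) \<longrightarrow> u \<le> Inf S)"
proof -
  let ?L = "{u. \<forall>x\<in>S. u \<le> x}"
  have L: "?L \<noteq> {}" "bdd_above ?L"
    using assms by (auto simp: bdd_below_def bdd_above_def)
  obtain s where s: "\<forall>x\<in>?L. x \<le> s" "\<And>u. \<forall>x\<in>?L. x \<le> u \<Longrightarrow> s \<le> u"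
    using decimal_lub_exists[OF L] by blast
  show ?thesis unfolding Inf_decimal_def
    by (rule theI[of _ s]) (use s in \<open>auto intro: antisym\<close>)
qed

instance
proof
  fix x y z :: decimal and S :: "decimal set"
  show "x \<in> S \<Longrightarrow> bdd_below S \<Longrightarrow> Inf S \<le> x" using decimal_Inf by blast
  show "S \<noteq> {} \<Longrightarrow> (\<And>x. x \<in> S \<Longrightarrow> z \<le> x) \<Longrightarrow> z \<le> Inf S"
    by (metis decimal_Inf bdd_below.I)
  show "x \<in> S \<Longrightarrow> bdd_above S \<Longrightarrow> x \<le> Sup S" using decimal_Sup by blast
  show "S \<noteq> {} \<Longrightarrow> (\<And>x. x \<in> S \<Longrightarrow> x \<le> z) \<Longrightarrow> Sup S \<le> z"
    by (metis decimal_Sup bdd_above.I)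
qed (auto simp: sup_decimal_def inf_decimal_def)

end


section \<open>The rationals as formal decimals\<close>

text \<open>Long division of \<open>q\<close> by \<open>p > 0\<close>: \<open>ld_rem\<close> gives the remainders and \<open>ld_digit\<close> the digits.
  A rational is divided out from its reduced fraction; by \<open>scaled_long_division\<close> below, the digits
  depend only on the quotient.\<close>

primrec ld_rem :: "int \<Rightarrow> int \<Rightarrow> nat \<Rightarrow> int" where
  "ld_rem q p 0 = q - (q div p) * p"
| "ld_rem q p (Suc k) = 10 * ld_rem q p k - (10 * ld_rem q p k div p) * p"

fun ld_digit :: "int \<Rightarrow> int \<Rightarrow> nat \<Rightarrow> int" where
  "ld_digit q p 0 = q div p"
| "ld_digit q p (Suc k) = 10 * ld_rem q p k div p"

lemma ld_rem_bounds: "0 < p \<Longrightarrow> 0 \<le> ld_rem q p k \<and> ld_rem q p k < p"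
  by (cases k) (simp_all add: minus_div_mult_eq_mod)

lemma ld_digit_bounds: assumes "0 < p" "1 \<le> k" shows "ld_digit q p k \<in> {0..9}"
proof -
  obtain j where k: "k = Suc j" using assms(2) by (cases k) auto
  have r: "0 \<le> ld_rem q p j" "ld_rem q p j < p"
    using ld_rem_bounds[OF assms(1)] by auto
  have "10 * ld_rem q p j < 10 * p" using r by simp
  then have "10 * ld_rem q p j div p < 10"
    using assms(1) mult_right_mono[of 10 "10 * ld_rem q p j div p" p]
      minus_div_mult_eq_mod[of "10 * ld_rem q p j" p] pos_mod_sign[of p "10 * ld_rem q p j"]
    by linarith
  moreover have "0 \<le> 10 * ld_rem q p j div p"
    using r assms(1) by (simp add: pos_imp_zdiv_nonneg_iff)
  ultimately show ?thesis by (simp add: k)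
qed

lift_definition decimal_of_rat :: "rat \<Rightarrow> decimal"
  is "\<lambda>\<alpha>. ld_digit (fst (quotient_of \<alpha>)) (snd (quotient_of \<alpha>))"
  by (auto simp del: atLeastAtMost_iff intro: ld_digit_bounds quotient_of_denom_pos')

lemma scaled_long_division:
  assumes "0 < p" "digit x = ld_digit q p"
  shows "scaled x k = \<lfloor>of_int q / of_int p * 10 ^ k :: rat\<rfloor>"
proof -
  have "scaled x k * p + ld_rem q p k = q * 10 ^ k" for k
  proof (induction k)
    case (Suc k)
    have "scaled x (Suc k) * p + ld_rem q p (Suc k) = 10 * (scaled x k * p + ld_rem q p k)"
      by (simp add: assms(2) algebra_simps)
    then show ?case by (simp add: Suc)
  qed (simp add: assms(2))
  then have "scaled x k = (q * 10 ^ k) div p"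
    using ld_rem_bounds[OF assms(1), of q k] assms(1)
    by (metis add.commute div_mult_self3 div_pos_pos_trivial add_0 less_irrefl)
  also have "\<dots> = \<lfloor>of_int (q * 10 ^ k) / of_int p :: rat\<rfloor>" by (simp only: floor_divide_of_int_eq)
  finally show ?thesis by simp
qed

lemma scaled_of_rat: "scaled (decimal_of_rat \<alpha>) k = \<lfloor>\<alpha> * 10 ^ k\<rfloor>"
proof -
  have "\<alpha> = of_int (fst (quotient_of \<alpha>)) / of_int (snd (quotient_of \<alpha>))"
    by (metis prod.collapse quotient_of_div)
  with scaled_long_division[OF quotient_of_denom_pos' decimal_of_rat.rep_eq, of \<alpha> k]
  show ?thesis by simp
qed


section \<open>The real value of a formal decimal\<close>

text \<open>This section is auxiliary: \<open>val\<close> is only used to show that the quotient below and the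
  addition on it are well defined.\<close>

definition val :: "decimal \<Rightarrow> real"
  where "val x = (SUP k. of_int (scaled x k) / 10 ^ k)"

lemma scaled_bounds:
  assumes "k \<le> j"
  shows "scaled x k * 10 ^ (j - k) \<le> scaled x j"
    "scaled x j + 1 \<le> (scaled x k + 1) * 10 ^ (j - k)"
proof -
  have "scaled x k * 10 ^ (j - k) \<le> scaled x j
      \<and> scaled x j + 1 \<le> (scaled x k + 1) * 10 ^ (j - k)"
    using assms
  proof (induction j rule: dec_induct)
    case (step j)
    then have "(10::int) ^ (Suc j - k) = 10 * 10 ^ (j - k)"
      by (simp add: Suc_diff_le)
    then show ?case using step digit_bounds[of x j] by (simp add: algebra_simps)
  qed simp
  then show "scaled x k * 10 ^ (j - k) \<le> scaled x j"
    "scaled x j + 1 \<le> (scaled x k + 1) * 10 ^ (j - k)" by auto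
qed

lemma scaled_upper: "of_int (scaled x j) / 10 ^ j \<le> (of_int (scaled x k) + 1) / (10 ^ k :: real)"
proof (cases "k \<le> j")
  case True
  have "real_of_int (scaled x j + 1) \<le> of_int ((scaled x k + 1) * 10 ^ (j - k))"
    using scaled_bounds(2)[OF True] of_int_le_iff by blast
  moreover have "(10::real) ^ j = 10 ^ k * 10 ^ (j - k)"
    using True by (simp flip: power_add)
  ultimately show ?thesis by (simp add: field_simps)
next
  case False
  then have kj: "j \<le> k" by simp
  have "real_of_int (scaled x j * 10 ^ (k - j)) \<le> of_int (scaled x k)"
    using scaled_bounds(1)[OF kj] of_int_le_iff by blast
  moreover have "(10::real) ^ k = 10 ^ j * 10 ^ (k - j)"
    using kj by (simp flip: power_add)
  ultimately show ?thesis by (simp add: field_simps)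
qed

lemma val_bounds:
  "of_int (scaled x k) / 10 ^ k \<le> val x" "val x \<le> (of_int (scaled x k) + 1) / 10 ^ k"
proof -
  have "bdd_above (range (\<lambda>k. of_int (scaled x k) / (10 ^ k :: real)))"
    using scaled_upper[of x _ 0] by (intro bdd_aboveI2)
  then show "of_int (scaled x k) / 10 ^ k \<le> val x"
    unfolding val_def by (rule cSUP_upper2) auto
  show "val x \<le> (of_int (scaled x k) + 1) / 10 ^ k"
    unfolding val_def by (rule cSUP_least) (auto intro: scaled_upper)
qed

lemma small_power: assumes "0 < (e::real)" obtains k where "1 / 10 ^ k < e"
  using real_arch_pow_inv[of e "1/10"] assms by (auto simp: power_one_over)

lemma val_mono: assumes "x \<le> y" shows "val x \<le> val y"
proof (rule field_le_epsilon)
  fix e :: real assume "0 < e"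
  then obtain k where k: "1 / 10 ^ k < e" by (rule small_power)
  have "val x \<le> of_int (scaled x k) / 10 ^ k + 1 / 10 ^ k"
    using val_bounds(2)[of x k] by (simp add: add_divide_distrib)
  also have "of_int (scaled x k) / 10 ^ k \<le> of_int (scaled y k) / (10 ^ k :: real)"
    using assms by (simp add: decimal_le_iff divide_right_mono)
  also have "\<dots> \<le> val y" by (rule val_bounds)
  finally show "val x \<le> val y + e" using k by simp
qed

lemma val_less_imp_less: "val x < val y \<Longrightarrow> x < y"
  using val_mono by (meson leD linorder_le_less_linear)

lemma val_of_floor:
  assumes "\<And>k. scaled x k = \<lfloor>r * 10 ^ k\<rfloor>" shows "val x = r"
proof -
  have "of_int (scaled x k) / 10 ^ k \<le> r" "r \<le> (of_int (scaled x k) + 1) / 10 ^ k" for k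
    unfolding assms by (simp_all add: field_simps) linarith
  note b = this val_bounds[of x]
  have "\<bar>val x - r\<bar> \<le> 1 / 10 ^ k" for k
    using b[of k] by (simp add: add_divide_distrib)
  then show ?thesis
    using small_power[of "\<bar>val x - r\<bar>"]
    by (metis abs_le_zero_iff eq_iff_diff_eq_0 linorder_not_le)
qed

lemma val_of_rat: "val (decimal_of_rat \<alpha>) = of_rat \<alpha>"
proof (rule val_of_floor)
  fix k
  have "\<lfloor>\<alpha> * 10 ^ k\<rfloor> = \<lfloor>real_of_rat (\<alpha> * 10 ^ k)\<rfloor>" by simp
  also have "real_of_rat (\<alpha> * 10 ^ k) = of_rat \<alpha> * 10 ^ k"
    by (simp add: of_rat_mult of_rat_power)
  finally show "scaled (decimal_of_rat \<alpha>) k = \<lfloor>real_of_rat \<alpha> * 10 ^ k\<rfloor>"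
    by (simp only: scaled_of_rat)
qed

lemma decimal_of_rat_mono: "\<alpha> \<le> \<beta> \<Longrightarrow> decimal_of_rat \<alpha> \<le> decimal_of_rat \<beta>"
  by (simp add: decimal_le_iff scaled_of_rat floor_mono)

lemma rat_between: assumes "r < (s::real)" obtains \<alpha> where "r < of_rat \<alpha>" "of_rat \<alpha> < s"
  using of_rat_dense[OF assms] by blast

lemma val_Sup:
  assumes "S \<noteq> {}" "bdd_above S" shows "val (Sup S) = Sup (val ` S)"
proof (rule antisym)
  have bdd: "bdd_above (val ` S)"
    using assms(2) val_mono by (auto simp: bdd_above_def)
  show "Sup (val ` S) \<le> val (Sup S)"
    using assms by (intro cSUP_least) (auto intro: val_mono cSup_upper)
  show "val (Sup S) \<le> Sup (val ` S)"
  proof (rule ccontr)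
    assume "\<not> ?thesis"
    then have "Sup (val ` S) < val (Sup S)" by simp
    then obtain \<alpha> where \<alpha>: "Sup (val ` S) < of_rat \<alpha>" "of_rat \<alpha> < val (Sup S)"
      by (rule rat_between)
    have "x \<le> decimal_of_rat \<alpha>" if "x \<in> S" for x
      using cSUP_upper[OF that bdd] \<alpha>(1) val_less_imp_less[of x "decimal_of_rat \<alpha>"]
      by (simp add: val_of_rat)
    then have "Sup S \<le> decimal_of_rat \<alpha>" using assms(1) by (intro cSup_least)
    from val_mono[OF this] \<alpha>(2) show False by (simp add: val_of_rat)
  qed
qed

lemma val_Inf:
  assumes "S \<noteq> {}" "bdd_below S" shows "val (Inf S) = Inf (val ` S)"
proof (rule antisym)
  have bdd: "bdd_below (val ` S)"
    using assms(2) val_mono by (auto simp: bdd_below_def)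
  show "val (Inf S) \<le> Inf (val ` S)"
    using assms by (intro cINF_greatest) (auto intro: val_mono cInf_lower)
  show "Inf (val ` S) \<le> val (Inf S)"
  proof (rule ccontr)
    assume "\<not> ?thesis"
    then have "val (Inf S) < Inf (val ` S)" by simp
    then obtain \<alpha> where \<alpha>: "val (Inf S) < of_rat \<alpha>" "of_rat \<alpha> < Inf (val ` S)"
      by (rule rat_between)
    have "decimal_of_rat \<alpha> \<le> x" if "x \<in> S" for x
      using cINF_lower[OF bdd that] \<alpha>(2) val_less_imp_less[of "decimal_of_rat \<alpha>" x]
      by (simp add: val_of_rat)
    then have "decimal_of_rat \<alpha> \<le> Inf S" using assms(1) by (intro cInf_greatest)
    from val_mono[OF this] \<alpha>(1) show False by (simp add: val_of_rat)
  qed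
qed


section \<open>The real numbers as a quotient\<close>

definition no_gap :: "decimal \<Rightarrow> decimal \<Rightarrow> bool"  (infix \<open>\<sim>\<close> 50)
  where "x \<sim> y \<longleftrightarrow> \<not> (\<exists>z. x < z \<and> z < y \<or> y < z \<and> z < x)"

lemma val_less_of_between:
  assumes "x < y" "y < z" shows "val x < val z"
proof -
  obtain j k where jk: "scaled x j < scaled y j" "scaled y k < scaled z k"
    using assms by (auto simp: decimal_less_iff)
  define m where "m = max j k"
  have "scaled x m < scaled y m" "scaled y m < scaled z m"
    using jk scaled_less_mono unfolding m_def by (meson max.cobounded1 max.cobounded2)+
  then have "real_of_int (scaled x m) + 1 < of_int (scaled z m)" by linarith
  then have "(real_of_int (scaled x m) + 1) / 10 ^ m < of_int (scaled z m) / 10 ^ m"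
    by (simp add: divide_strict_right_mono)
  then show ?thesis using val_bounds(2)[of x m] val_bounds(1)[of z m] by linarith
qed

lemma between_of_val_less:
  assumes "val x < val y" obtains z where "x < z" "z < y"
proof -
  obtain \<alpha> where "val x < of_rat \<alpha>" "of_rat \<alpha> < val y" using assms by (rule rat_between)
  then show ?thesis
    by (intro that[of "decimal_of_rat \<alpha>"] val_less_imp_less) (simp_all add: val_of_rat)
qed

lemma no_gap_iff_val: "x \<sim> y \<longleftrightarrow> val x = val y"
  unfolding no_gap_def
  by (metis between_of_val_less val_less_of_between linorder_neq_iff)

quotient_type dreal = decimal / no_gap
  by (rule equivpI) (auto intro!: reflpI sympI transpI simp: no_gap_iff_val)


section \<open>Limits and addition\<close>

text \<open>Sequences are indexed by the positive integers; the term at index 0 is ignored.\<close>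

definition upper_LIMIT :: "(nat \<Rightarrow> decimal) \<Rightarrow> decimal"
  where "upper_LIMIT X = Inf {Sup {X k | k. k \<ge> n} | n. n \<ge> 1}"

definition lower_LIMIT :: "(nat \<Rightarrow> decimal) \<Rightarrow> decimal"
  where "lower_LIMIT X = Sup {Inf {X k | k. k \<ge> n} | n. n \<ge> 1}"

definition LIMIT :: "(nat \<Rightarrow> decimal) \<Rightarrow> decimal"
  where "LIMIT X = (THE L. upper_LIMIT X = L \<and> lower_LIMIT X = L)"

definition decimal_add :: "decimal \<Rightarrow> decimal \<Rightarrow> decimal"  (infixl \<open>\<oplus>\<close> 65)
  where "x \<oplus> y = LIMIT (\<lambda>k. decimal_of_rat (trunc x k + trunc y k))"

lemma LIMIT_incseq:
  assumes inc: "incseq X" and bdd: "bdd_above (range X)"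
  shows "upper_LIMIT X = Sup (range X)" "lower_LIMIT X = Sup (range X)"
    "LIMIT X = Sup (range X)"
proof -
  have tail: "Sup {X k | k. k \<ge> n} = Sup (range X)" for n
  proof (rule antisym)
    show "Sup {X k | k. k \<ge> n} \<le> Sup (range X)"
      by (rule cSup_subset_mono) (use bdd in auto)
    have "bdd_above {X k | k. k \<ge> n}" by (rule bdd_above_mono[OF bdd]) auto
    then have "X k \<le> Sup {X k | k. k \<ge> n}" for k
      by (rule cSup_upper2[of "X (max n k)", rotated -1])
         (auto intro: incseqD[OF inc])
    then show "Sup (range X) \<le> Sup {X k | k. k \<ge> n}" by (intro cSUP_least) auto
  qed
  have "{Sup {X k | k. k \<ge> n} | n. n \<ge> 1} = {Sup (range X)}" unfolding tail by auto
  then show u: "upper_LIMIT X = Sup (range X)" by (simp add: upper_LIMIT_def)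
  have "Inf {X k | k. k \<ge> n} = X n" for n
    by (rule cInf_eq_minimum) (auto intro: incseqD[OF inc])
  then have "lower_LIMIT X = Sup {X n | n. n \<ge> 1}" by (simp add: lower_LIMIT_def)
  then show l: "lower_LIMIT X = Sup (range X)" by (simp only: tail)
  show "LIMIT X = Sup (range X)" by (simp add: LIMIT_def u l)
qed

lemma val_add: "val (x \<oplus> y) = val x + val y"
proof -
  define t where "t x k = of_int (scaled x k) / (10 ^ k :: real)" for x k
  define X where "X k = decimal_of_rat (trunc x k + trunc y k)" for k
  have t_trunc: "of_rat (trunc x k) = t x k" for x k
    by (simp add: trunc_scaled t_def of_rat_divide of_rat_power)
  have t_le: "t x k \<le> val x" and t_ge: "val x \<le> t x k + 1 / 10 ^ k" for x k
    using val_bounds[of x k] by (simp_all add: t_def add_divide_distrib)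
  have valX: "val (X k) = t x k + t y k" for k
    by (simp add: X_def val_of_rat of_rat_add t_trunc)
  have trunc_mono: "trunc x k \<le> trunc x (Suc k)" for x k
    using digit_bounds(1)[of x k] by (simp add: trunc_def)
  have inc: "incseq X"
    unfolding X_def by (intro incseq_SucI decimal_of_rat_mono add_mono trunc_mono)
  obtain \<alpha> where \<alpha>: "val x + val y < of_rat \<alpha>"
    using rat_between[of "val x + val y" "val x + val y + 1"] by auto
  have bdd: "bdd_above (range X)"
  proof (rule bdd_aboveI2)
    fix k
    have "val (X k) < val (decimal_of_rat \<alpha>)"
      using \<alpha> t_le[of x k] t_le[of y k] by (simp add: valX val_of_rat)
    then show "X k \<le> decimal_of_rat \<alpha>" by (intro less_imp_le val_less_imp_less)
  qed
  have bddv: "bdd_above (range (\<lambda>k. val (X k)))"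
    using t_le by (intro bdd_aboveI2[where M = "val x + val y"]) (simp add: valX add_mono)
  have "val (x \<oplus> y) = (SUP k. val (X k))"
    unfolding decimal_add_def X_def[symmetric] LIMIT_incseq(3)[OF inc bdd]
    using val_Sup[OF _ bdd] by (simp add: image_image)
  also have "\<dots> = val x + val y"
  proof (rule antisym)
    show "(SUP k. val (X k)) \<le> val x + val y"
      by (rule cSUP_least) (auto simp: valX intro: add_mono t_le)
    show "val x + val y \<le> (SUP k. val (X k))"
    proof (rule field_le_epsilon)
      fix e :: real assume "0 < e"
      then obtain k where k: "1 / 10 ^ k < e / 2" using small_power[of "e / 2"] by auto
      have "val x + val y \<le> val (X k) + e"
        using t_ge[of x k] t_ge[of y k] k by (simp add: valX)
      also have "val (X k) \<le> (SUP k. val (X k))" by (rule cSUP_upper[OF _ bddv]) simp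
      finally show "val x + val y \<le> (SUP k. val (X k)) + e" by simp
    qed
  qed
  finally show ?thesis .
qed

lift_definition dreal_add :: "dreal \<Rightarrow> dreal \<Rightarrow> dreal"  (infixl \<open>\<oplus>\<^sub>R\<close> 65)
  is decimal_add
  by (simp add: no_gap_iff_val val_add)


section \<open>Dedekind cuts\<close>

text \<open>In a generalized cut the lower part may have a greatest element.\<close>

definition generalized_cuts :: "(rat set \<times> rat set) set"
  where "generalized_cuts = {(A, B). A \<noteq> {} \<and> B \<noteq> {} \<and> A \<inter> B = {} \<and> A \<union> B = UNIV \<and>
    (\<forall>a\<in>A. \<forall>b\<in>B. a < b)}"

definition DR :: "(rat set \<times> rat set) set"
  where "DR = {(A, B). (A, B) \<in> generalized_cuts \<and> \<not> (\<exists>m\<in>A. \<forall>a\<in>A. a \<le> m)}"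

text \<open>The set \<open>{m \<in> A. \<forall>a\<in>A. a \<le> m}\<close> holds the greatest element of \<open>A\<close> if there is one, and is
  empty otherwise.\<close>

definition cut_of_generalized :: "rat set \<times> rat set \<Rightarrow> rat set \<times> rat set"
  where "cut_of_generalized = (\<lambda>(A, B).
    (A - {m \<in> A. \<forall>a\<in>A. a \<le> m}, B \<union> {m \<in> A. \<forall>a\<in>A. a \<le> m}))"

definition cut_add :: "rat set \<times> rat set \<Rightarrow> rat set \<times> rat set \<Rightarrow> rat set \<times> rat set"
    (infixl \<open>\<oplus>\<^sub>D\<close> 65)
  where "P \<oplus>\<^sub>D Q = (case (P, Q) of ((A, B), (C, D)) \<Rightarrow> cut_of_generalized (UNIV - (B + D), B + D))"

definition \<tau> :: "rat set \<times> rat set \<Rightarrow> dreal"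
  where "\<tau> = (\<lambda>(A, B). abs_dreal (Sup (decimal_of_rat ` A)))"

lemma tau_Inf:
  assumes "(A, B) \<in> DR"
  shows "\<tau> (A, B) = abs_dreal (Inf (decimal_of_rat ` B))"
proof -
  have cut: "A \<noteq> {}" "B \<noteq> {}" "A \<union> B = UNIV" and lt: "\<And>a b. a \<in> A \<Longrightarrow> b \<in> B \<Longrightarrow> a < b"
    using assms by (auto simp: DR_def generalized_cuts_def)
  have le: "decimal_of_rat a \<le> decimal_of_rat b" if "a \<in> A" "b \<in> B" for a b
    using lt[OF that] by (simp add: decimal_of_rat_mono)
  have bdd: "bdd_above (decimal_of_rat ` A)" "bdd_below (decimal_of_rat ` B)"
    using cut(1,2) le by (meson bdd_aboveI2 bdd_belowI2 ex_in_conv)+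
  have "val (Sup (decimal_of_rat ` A)) = val (Inf (decimal_of_rat ` B))"
  proof (rule antisym)
    show "val (Sup (decimal_of_rat ` A)) \<le> val (Inf (decimal_of_rat ` B))"
      using cut le by (intro val_mono cSUP_least cINF_greatest) auto
    show "val (Inf (decimal_of_rat ` B)) \<le> val (Sup (decimal_of_rat ` A))"
    proof (rule ccontr)
      assume "\<not> ?thesis"
      then have "val (Sup (decimal_of_rat ` A)) < val (Inf (decimal_of_rat ` B))" by simp
      then obtain \<alpha> where \<alpha>: "val (Sup (decimal_of_rat ` A)) < of_rat \<alpha>"
        "of_rat \<alpha> < val (Inf (decimal_of_rat ` B))"
        by (rule rat_between)
      have "\<alpha> \<notin> A" using \<alpha>(1) val_mono[OF cSUP_upper[OF _ bdd(1), of \<alpha>]]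
        by (auto simp: val_of_rat)
      moreover have "\<alpha> \<notin> B" using \<alpha>(2) val_mono[OF cINF_lower[OF bdd(2), of \<alpha>]]
        by (auto simp: val_of_rat)
      ultimately show False using cut(3) by blast
    qed
  qed
  then show ?thesis by (simp add: \<tau>_def dreal.abs_eq_iff no_gap_iff_val)
qed

lemma cut_of_generalized_DR:
  assumes "P \<in> generalized_cuts" shows "cut_of_generalized P \<in> DR"
proof -
  obtain A B where P: "P = (A, B)" by (cases P)
  have cut: "A \<noteq> {}" "B \<noteq> {}" "A \<inter> B = {}" "A \<union> B = UNIV"
    and lt: "\<And>a b. a \<in> A \<Longrightarrow> b \<in> B \<Longrightarrow> a < b"
    using assms by (auto simp: P generalized_cuts_def)
  have down: "x \<in> A" if "a \<in> A" "x \<le> a" for x a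
    using cut(4) lt[OF that(1), of x] that(2) by fastforce
  define G where "G = {m \<in> A. \<forall>a\<in>A. a \<le> m}"
  have GI: "x \<in> G" if "x \<in> A" "\<And>a. a \<in> A \<Longrightarrow> a \<le> x" for x using that by (simp add: G_def)
  have GD: "m \<in> A" "a \<in> A \<Longrightarrow> a \<le> m" if "m \<in> G" for m a using that by (auto simp: G_def)
  have "A - G \<noteq> {}"
  proof
    assume "A - G = {}"
    then obtain m where m: "m \<in> A" "m \<in> G" using cut(1) by blast
    then have "m - 1 \<in> A - G" using down[of m "m - 1"] GD(2)[of "m - 1" m] by auto
    with \<open>A - G = {}\<close> show False by blast
  qed
  moreover have "a < b" if "a \<in> A - G" "b \<in> B \<union> G" for a b
  proof (cases "b \<in> B")
    case False
    then show ?thesis using that GD(2)[of b a] by (cases "a = b") auto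
  qed (use that lt in auto)
  moreover have "\<exists>a\<in>A - G. n < a" if n: "n \<in> A - G" for n
  proof -
    obtain m where m: "m \<in> A" "n < m" using n GI[of n] by force
    define h where "h = (n + m) / 2"
    have h: "n < h" "h < m" using m(2) by (simp_all add: h_def)
    then have "h \<in> A - G" using down[OF m(1), of h] GD(2)[of h m] m(1) by auto
    with h(1) show ?thesis by blast
  qed
  ultimately show ?thesis
    using cut unfolding P cut_of_generalized_def DR_def generalized_cuts_def
    by (simp add: G_def[symmetric]) (use GD(1) in \<open>fastforce simp: not_le\<close>)
qed

lemma cut_add_generalized:
  assumes "(A, B) \<in> DR" "(C, D) \<in> DR"
  shows "(UNIV - (B + D), B + D) \<in> generalized_cuts"
proof -
  have cut: "A \<noteq> {}" "B \<noteq> {}" "C \<noteq> {}" "D \<noteq> {}" "C \<union> D = UNIV"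
    and lt: "\<And>a b. a \<in> A \<Longrightarrow> b \<in> B \<Longrightarrow> a < b" "\<And>c d. c \<in> C \<Longrightarrow> d \<in> D \<Longrightarrow> c < d"
    using assms by (auto simp: DR_def generalized_cuts_def)
  obtain a b c d where abcd: "a \<in> A" "b \<in> B" "c \<in> C" "d \<in> D" using cut by blast
  have "a + c \<notin> B + D"
    using lt(1)[OF abcd(1)] lt(2)[OF abcd(3)] by (force simp: set_plus_def dest: add_strict_mono)
  moreover have "b + d \<in> B + D" using abcd by (auto simp: set_plus_def)
  moreover have "x < y" if x: "x \<notin> B + D" and "y \<in> B + D" for x y
  proof (rule ccontr)
    assume "\<not> x < y"
    obtain b d where y: "y = b + d" "b \<in> B" "d \<in> D" using \<open>y \<in> B + D\<close> by (auto simp: set_plus_def)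
    have "d + (x - y) \<in> D"
      using cut(5) lt(2)[of "d + (x - y)" d] y(3) \<open>\<not> x < y\<close> by fastforce
    moreover have "x = b + (d + (x - y))" by (simp add: y(1))
    ultimately show False using x y(2) by (metis set_plus_intro)
  qed
  ultimately show ?thesis by (auto simp: generalized_cuts_def)
qed

lemma cut_add_DR:
  assumes "(A, B) \<in> DR" "(C, D) \<in> DR" shows "(A, B) \<oplus>\<^sub>D (C, D) \<in> DR"
  using assms by (simp add: cut_add_def cut_of_generalized_DR cut_add_generalized)

end

theory Submission
  imports Defs
begin

text \<open>The value of \<open>\<tau>\<close> at a cut is the real infimum of its upper part, and real infima are additive
  under Minkowski sums. Moving the greatest element of the lower part to the upper part does not
  change the infimum of the latter, since by density no rational lies strictly between that element
  and the infimum.\<close>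

text \<open>Two decimals have no gap exactly when their values agree, so infima may be compared in
  the reals. There \<open>val\<close> commutes with infima and sends the expansion of a rational to
  that rational.\<close>

lemma val_Inf_of_rat:
  assumes "B \<noteq> {}" "bdd_below B"
  shows "val (Inf (decimal_of_rat ` B)) = (INF b\<in>B. of_rat b)"
proof -
  have "bdd_below (decimal_of_rat ` B)"
    using assms(2) by (auto simp: bdd_below_def intro: decimal_of_rat_mono)
  then show ?thesis
    using assms(1) by (simp add: val_Inf image_image val_of_rat)
qed

lemma bdd_below_of_rat: "bdd_below B \<Longrightarrow> bdd_below (of_rat ` B :: real set)"
  unfolding bdd_below_def by (metis imageE of_rat_less_eq)

lemma generalized_cut_upper:
  assumes "(A, B) \<in> generalized_cuts"
  shows "B \<noteq> {}" "bdd_below B"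
proof -
  show "B \<noteq> {}"
    using assms by (simp add: generalized_cuts_def)
  obtain a where "\<forall>b\<in>B. a < b"
    using assms unfolding generalized_cuts_def by blast
  then show "bdd_below B"
    by (intro bdd_belowI[of _ a]) (simp add: less_imp_le)
qed

lemma DR_generalized: "P \<in> DR \<Longrightarrow> P \<in> generalized_cuts"
  by (auto simp: DR_def)

lemma Inf_set_plus:
  fixes S T :: "real set"
  assumes "S \<noteq> {}" "bdd_below S" "T \<noteq> {}" "bdd_below T"
  shows "Inf (S + T) = Inf S + Inf T"
proof (rule cInf_eq_non_empty)
  show "S + T \<noteq> {}"
    using assms by (auto simp: set_plus_def)
  show "Inf S + Inf T \<le> x" if "x \<in> S + T" for x
    using that assms by (auto simp: set_plus_def intro!: add_mono cInf_lower)
  show "y \<le> Inf S + Inf T" if y: "\<And>x. x \<in> S + T \<Longrightarrow> y \<le> x" for y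
  proof -
    \<comment> \<open>The two infima are split off one at a time: for fixed \<open>t\<close>,
      \<open>y - t\<close> bounds \<open>S\<close> from below; hence \<open>y - Inf S\<close> bounds
      \<open>T\<close> from below.\<close>
    have "y - t \<le> Inf S" if "t \<in> T" for t
      using assms(1) y that by (intro cInf_greatest) (auto simp: diff_le_eq intro: set_plus_intro)
    then have "y - Inf S \<le> Inf T"
      using assms(3) by (intro cInf_greatest) (auto simp: algebra_simps)
    then show ?thesis by simp
  qed
qed

lemma of_rat_image_set_plus:
  "of_rat ` (B + D) = (of_rat ` B + of_rat ` D :: 'a :: field_char_0 set)"
  by (force simp: set_plus_def of_rat_add)

lemma tau_cut_of_generalized:
  assumes "(A, B) \<in> generalized_cuts"
  shows "\<tau> (cut_of_generalized (A, B)) = abs_dreal (Inf (decimal_of_rat ` B))"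
proof -
  define G where "G = {m \<in> A. \<forall>a\<in>A. a \<le> m}"
  have eq: "cut_of_generalized (A, B) = (A - G, B \<union> G)"
    by (simp add: cut_of_generalized_def G_def)
  \<comment> \<open>\<open>tau_Inf\<close> speaks of proper cuts only, so it is applied to the
    normalised cut; what remains is to compare the infima of \<open>B \<union> G\<close> and
    \<open>B\<close>.\<close>
  then have DR: "(A - G, B \<union> G) \<in> DR"
    using cut_of_generalized_DR[OF assms] by simp
  note B = generalized_cut_upper[OF assms]
  have "A \<union> B = UNIV"
    using assms by (simp add: generalized_cuts_def)
  have bdd: "bdd_below (B \<union> G)"
    using generalized_cut_upper(2)[OF DR_generalized[OF DR]] .
  have "(INF b\<in>B. real_of_rat b) \<le> of_rat g" if "g \<in> G" for g
  proof (rule ccontr)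
    assume "\<not> ?thesis"
    then have "of_rat g < (INF b\<in>B. real_of_rat b)" by simp
    \<comment> \<open>Such an \<open>h\<close> lies below the infimum of \<open>B\<close>, so it
      belongs to \<open>A\<close>, yet it exceeds the greatest element \<open>g\<close> of
      \<open>A\<close>.\<close>
    then obtain h where h: "real_of_rat g < of_rat h" "of_rat h < (INF b\<in>B. real_of_rat b)"
      by (rule rat_between)
    then have "h \<notin> B"
      using cINF_lower[OF bdd_below_of_rat[OF B(2)], of h] by auto
    then have "h \<le> g"
      using \<open>A \<union> B = UNIV\<close> \<open>g \<in> G\<close> by (auto simp: G_def)
    with h(1) show False by (simp add: of_rat_less)
  qed
  then have "(INF b\<in>B \<union> G. real_of_rat b) = (INF b\<in>B. of_rat b)"
    using B(1) cINF_lower[OF bdd_below_of_rat[OF B(2)]]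
    by (intro antisym cINF_superset_mono cINF_greatest bdd_below_of_rat[OF bdd]) auto
  then show ?thesis
    using B bdd
    by (simp add: eq tau_Inf[OF DR] dreal.abs_eq_iff no_gap_iff_val val_Inf_of_rat)
qed

theorem theorem6p9:
  fixes A B C D :: "rat set"
  assumes "(A, B) \<in> DR" and "(C, D) \<in> DR"
  shows "\<tau> ((A, B) \<oplus>\<^sub>D (C, D)) = \<tau> (A, B) \<oplus>\<^sub>R \<tau> (C, D)"
proof -
  note gen = cut_add_generalized[OF assms]
  \<comment> \<open>\<open>B + D\<close> is the upper part of the sum before normalisation, and
    \<open>tau_cut_of_generalized\<close> allows its infimum to be used directly.\<close>
  have "val (Inf (decimal_of_rat ` (B + D)))
      = val (Inf (decimal_of_rat ` B)) + val (Inf (decimal_of_rat ` D))"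
    using assms[THEN DR_generalized, THEN generalized_cut_upper(1)]
      assms[THEN DR_generalized, THEN generalized_cut_upper(2)]
    by (simp add: generalized_cut_upper[OF gen] val_Inf_of_rat of_rat_image_set_plus
        Inf_set_plus bdd_below_of_rat)
  then show ?thesis
    by (simp add: cut_add_def tau_cut_of_generalized[OF gen] tau_Inf assms dreal_add.abs_eq
        dreal.abs_eq_iff no_gap_iff_val val_add)
qed

end
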